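(* For every connected graph $G$ with maximum degree $\Delta(G)$, $$\operatorname{th}_{\rm pd}^{\times}(G)\ge\left\lceil\frac{|V(G)|}{\Delta(G)+1}\right\rceil.$$
   Context: All graphs are finite, simple and undirected with at least one vertex. Let $G$ be a graph and let $N[S]$ denote the closed neighborhood of $S\subseteq V(G)$. For nonempty $S\subseteq V(G)$ define $P^{[0]}(S)=S$, $P^{[1]}(S)=N[S]$, and for $i\ge 1$, $P^{[i+1]}(S)=P^{[i]}(S)\cup\{w\in V(G)\setminus P^{[i]}(S): \exists u\in P^{[i]}(S),\ N(u)\setminus P^{[i]}(S)=\{w\}\}$. $S$ is a power dominating set if $P^{[t]}(S)=V(G)$ for some $t$. The power propagation time $\operatorname{pt}_{\rm pd}(G;S)$ is the least positive integer $t$ with $P^{[t]}(S)=V(G)$ (so it is at least $1$, even for $S=V(G)$), and is $\infty$ if $S$ is not a power dominating set. The product power throttling number is $\operatorname{th}_{\rm pd}^{\times}(G)=\min_{\emptyset\ne S\subseteq V(G)}|S|\operatorname{pt}_{\rm pd}(G;S)$. *)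

theory Defs
  imports Complex_Main "HOL-Library.Extended_Nat" "Graph_Theory.Graph_Theory"
begin

text \<open>
  Finite simple undirected graphs are the finite, loop-free, symmetric digraphs without
  parallel arcs of the locale \<^locale>\<open>graph\<close>: an edge is a pair of opposite arcs.
  That the graph has a vertex is part of \<^const>\<open>Digraph_Component.connected\<close>.
\<close>

definition nbhd :: "('a, 'b) pre_digraph \<Rightarrow> 'a \<Rightarrow> 'a set" where
  "nbhd G u = {w \<in> verts G. u \<rightarrow>\<^bsub>G\<^esub> w}"

definition closed_nbhd :: "('a, 'b) pre_digraph \<Rightarrow> 'a set \<Rightarrow> 'a set" where
  "closed_nbhd G S = S \<union> (\<Union>u\<in>S. nbhd G u)"

definition max_degree :: "('a, 'b) pre_digraph \<Rightarrow> nat" where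
  "max_degree G = Max ((\<lambda>v. card (nbhd G v)) ` verts G)"

lemma (in nomulti_digraph) card_nbhd: "card (nbhd G v) = out_degree G v"
proof -
  have "nbhd G v = head G ` out_arcs G v"
    by (auto simp: nbhd_def out_arcs_def arcs_ends_conv)
  moreover have "inj_on (head G) (out_arcs G v)"
    by (auto simp: inj_on_def out_arcs_def arc_to_ends_def intro!: no_multi_arcs)
  ultimately show ?thesis
    by (simp add: out_degree_def card_image)
qed

text \<open>
  The first step is a domination step, every later step is a zero-forcing step.
\<close>

fun power_prop :: "('a, 'b) pre_digraph \<Rightarrow> 'a set \<Rightarrow> nat \<Rightarrow> 'a set" where
  "power_prop G S 0 = S"
| "power_prop G S (Suc 0) = closed_nbhd G S"
| "power_prop G S (Suc (Suc i)) = power_prop G S (Suc i) \<union>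
     {w \<in> verts G - power_prop G S (Suc i).
        \<exists>u \<in> power_prop G S (Suc i). nbhd G u - power_prop G S (Suc i) = {w}}"

definition power_dominating :: "('a, 'b) pre_digraph \<Rightarrow> 'a set \<Rightarrow> bool" where
  "power_dominating G S \<longleftrightarrow>
     S \<noteq> {} \<and> S \<subseteq> verts G \<and> (\<exists>t. power_prop G S t = verts G)"

definition pt_pd :: "('a, 'b) pre_digraph \<Rightarrow> 'a set \<Rightarrow> enat" where
  "pt_pd G S =
     (if power_dominating G S then enat (LEAST t. 0 < t \<and> power_prop G S t = verts G)
      else \<infinity>)"

definition th_pd_times :: "('a, 'b) pre_digraph \<Rightarrow> enat" where
  "th_pd_times G =
     Min ((\<lambda>S. enat (card S) * pt_pd G S) ` {S. S \<noteq> {} \<and> S \<subseteq> verts G})"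

end

theory Submission
  imports Defs
begin

text \<open>
  Call an observed vertex active if it still has an unobserved neighbour. After the domination
  step no vertex of \<open>S\<close> is active, so at most \<open>|S| \<Delta>\<close> vertices are. In a forcing step distinct
  new vertices have distinct active forcers, and these forcers become inactive; hence the number of
  active vertices never increases and bounds the number of new vertices in every step. After
  \<open>t \<ge> 1\<close> steps at most \<open>|S| (\<Delta> + 1) + (t - 1) |S| \<Delta> \<le> |S| t (\<Delta> + 1)\<close> vertices are observed.
\<close>

definition active :: "('a, 'b) pre_digraph \<Rightarrow> 'a set \<Rightarrow> 'a set" where
  "active G P = {u \<in> P. \<not> nbhd G u \<subseteq> P}"

text \<open>The increment of a forcing step in \<open>power_prop\<close>, isolated so that one step
  can be studied for an arbitrary observed set.\<close>

definition forced :: "('a, 'b) pre_digraph \<Rightarrow> 'a set \<Rightarrow> 'a set" where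
  "forced G P = {w \<in> verts G - P. \<exists>u \<in> P. nbhd G u - P = {w}}"

lemma power_prop_Suc_Suc:
  "power_prop G S (Suc (Suc i)) = power_prop G S (Suc i) \<union> forced G (power_prop G S (Suc i))"
  by (simp add: forced_def)

lemma nbhd_subset_verts: "nbhd G u \<subseteq> verts G"
  by (auto simp: nbhd_def)

lemma card_forced_and_active_step:
  assumes "finite P" "finite (verts G)"
  shows card_forced_le_active: "card (forced G P) \<le> card (active G P)"
    and card_active_step: "card (active G (P \<union> forced G P)) \<le> card (active G P)"
proof -
  define W where "W = forced G P"
  have finA: "finite (active G P)"
    using assms by (simp add: active_def)
  have finW: "finite W"
    using assms by (simp add: W_def forced_def)
  have "\<forall>w\<in>W. \<exists>u\<in>P. nbhd G u - P = {w}"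
    by (auto simp: W_def forced_def)
  then obtain f where f: "\<And>w. w \<in> W \<Longrightarrow> f w \<in> P" "\<And>w. w \<in> W \<Longrightarrow> nbhd G (f w) - P = {w}"
    by metis
  \<comment> \<open>A forcer determines the vertex it forces: its only neighbour outside
    \<open>P\<close>.\<close>
  have inj: "inj_on f W"
    using f(2) by (metis inj_onI singleton_inject)
  have sub: "f ` W \<subseteq> active G P"
    using f by (fastforce simp: active_def)
  show "card (forced G P) \<le> card (active G P)"
    using card_mono[OF finA sub] card_image[OF inj] by (simp add: W_def)
  have "nbhd G (f w) \<subseteq> P \<union> W" if "w \<in> W" for w
    using f(2)[OF that] that by (simp flip: Diff_subset_conv)
  \<comment> \<open>An old vertex still active was active before and is no chosen forcer, since
    those now see only observed vertices. Every other active vertex is new.\<close>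
  then have "active G (P \<union> W) \<subseteq> (active G P - f ` W) \<union> W"
    by (auto simp: active_def)
  then have "card (active G (P \<union> W)) \<le> card ((active G P - f ` W) \<union> W)"
    using finA finW by (intro card_mono) auto
  also have "\<dots> \<le> card (active G P - f ` W) + card W"
    by (rule card_Un_le)
  \<comment> \<open>The truncated subtraction is exact because \<open>f\<close> injects
    \<open>W\<close> into the active set.\<close>
  also have "\<dots> = card (active G P)"
    using card_mono[OF finA sub] card_image[OF inj] finW
    by (simp add: card_Diff_subset[OF _ sub])
  finally show "card (active G (P \<union> forced G P)) \<le> card (active G P)"
    by (simp add: W_def)
qed

lemma card_nbhd_le_max_degree:
  assumes "finite (verts G)" "v \<in> verts G"
  shows "card (nbhd G v) \<le> max_degree G"
  using assms by (simp add: max_degree_def)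

lemma card_UN_nbhd_le:
  assumes "finite (verts G)" "S \<subseteq> verts G"
  shows "card (\<Union>u\<in>S. nbhd G u) \<le> card S * max_degree G"
proof -
  have "card (\<Union>u\<in>S. nbhd G u) \<le> (\<Sum>u\<in>S. card (nbhd G u))"
    using assms by (intro card_UN_le) (rule finite_subset)
  also have "\<dots> \<le> (\<Sum>u\<in>S. max_degree G)"
    using assms by (intro sum_mono card_nbhd_le_max_degree) auto
  finally show ?thesis by simp
qed

lemma power_prop_subset_verts:
  assumes "S \<subseteq> verts G"
  shows "power_prop G S i \<subseteq> verts G"
  using assms
  by (induction G S i rule: power_prop.induct) (auto simp: closed_nbhd_def nbhd_def)

text \<open>The two bounds are proved together: the bound on active vertices limits how many
  vertices the next forcing step adds.\<close>

lemma card_power_prop_le: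
  assumes fin: "finite (verts G)" and S: "S \<subseteq> verts G"
  shows "card (active G (power_prop G S (Suc i))) \<le> card S * max_degree G"
    and "card (power_prop G S (Suc i)) \<le> card S + Suc i * (card S * max_degree G)"
proof (induction i)
  case 0
  let ?N = "\<Union>u\<in>S. nbhd G u"
  have finN: "finite ?N"
    using finite_subset[OF _ fin] nbhd_subset_verts[of G] by (metis UN_least)
  \<comment> \<open>Vertices of \<open>S\<close> have all their neighbours observed, so an active
    vertex must be a neighbour of \<open>S\<close>.\<close>
  have "active G (closed_nbhd G S) \<subseteq> ?N"
    by (auto simp: active_def closed_nbhd_def)
  from card_mono[OF finN this] card_UN_nbhd_le[OF fin S]
  show "card (active G (power_prop G S (Suc 0))) \<le> card S * max_degree G"
    by simp
  have "card (closed_nbhd G S) \<le> card S + card ?N"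
    unfolding closed_nbhd_def by (rule card_Un_le)
  with card_UN_nbhd_le[OF fin S]
  show "card (power_prop G S (Suc 0)) \<le> card S + Suc 0 * (card S * max_degree G)"
    by simp
next
  case (Suc i)
  let ?P = "power_prop G S (Suc i)"
  have finP: "finite ?P"
    using power_prop_subset_verts[OF S] fin by (rule finite_subset)
  show "card (active G (power_prop G S (Suc (Suc i)))) \<le> card S * max_degree G"
    unfolding power_prop_Suc_Suc using card_active_step[OF finP fin] Suc.IH(1) by simp
  have "card (power_prop G S (Suc (Suc i))) \<le> card ?P + card (forced G ?P)"
    unfolding power_prop_Suc_Suc by (rule card_Un_le)
  then show "card (power_prop G S (Suc (Suc i))) \<le> card S + Suc (Suc i) * (card S * max_degree G)"
    using card_forced_le_active[OF finP fin] Suc.IH by simp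
qed

lemma card_verts_le_if_power_prop:
  assumes "finite (verts G)" "S \<subseteq> verts G" "0 < t" "power_prop G S t = verts G"
  shows "card (verts G) \<le> card S * t * (max_degree G + 1)"
proof -
  obtain i where t: "t = Suc i"
    using \<open>0 < t\<close> gr0_implies_Suc by blast
  have "card (verts G) \<le> card S + t * (card S * max_degree G)"
    using card_power_prop_le(2)[OF assms(1,2), of i] assms(4) t by simp
  \<comment> \<open>As \<open>t\<close> is positive, the summand \<open>card S\<close> is at most
    \<open>card S * t\<close>.\<close>
  also have "\<dots> \<le> card S * t * (max_degree G + 1)"
    using \<open>0 < t\<close> by (simp add: algebra_simps)
  finally show ?thesis .
qed

text \<open>Makes the \<open>LEAST\<close> in \<open>pt_pd\<close> meaningful: domination may be
  witnessed by time 0, but then \<open>S\<close> is the whole vertex set and time 1 works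
  too.\<close>

lemma power_dominating_positive_time:
  assumes "power_dominating G S"
  shows "\<exists>t>0. power_prop G S t = verts G"
proof -
  obtain t where t: "power_prop G S t = verts G" and S: "S \<subseteq> verts G"
    using assms by (auto simp: power_dominating_def)
  show ?thesis
  proof (cases t)
    case 0
    then have "power_prop G S (Suc 0) = verts G"
      using t by (auto simp: closed_nbhd_def nbhd_def)
    then show ?thesis by blast
  qed (use t in blast)
qed

lemma ceiling_div_le_mult_pt_pd:
  assumes "finite (verts G)" "S \<noteq> {}" "S \<subseteq> verts G"
  shows "enat (nat \<lceil>real (card (verts G)) / real (max_degree G + 1)\<rceil>) \<le> enat (card S) * pt_pd G S"
proof (cases "power_dominating G S")
  case True
  define t where "t = (LEAST t. 0 < t \<and> power_prop G S t = verts G)"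
  have "0 < t \<and> power_prop G S t = verts G"
    unfolding t_def using power_dominating_positive_time[OF True] by (rule LeastI_ex)
  then have "card (verts G) \<le> card S * t * (max_degree G + 1)"
    using card_verts_le_if_power_prop assms by blast
  then have "real (card (verts G)) \<le> real (card S * t) * real (max_degree G + 1)"
    by (metis of_nat_le_iff of_nat_mult)
  then have "real (card (verts G)) / real (max_degree G + 1) \<le> real (card S * t)"
    by (simp add: divide_le_eq)
  \<comment> \<open>The upper bound is an integer, so it also bounds the ceiling.\<close>
  then have "nat \<lceil>real (card (verts G)) / real (max_degree G + 1)\<rceil> \<le> card S * t"
    by linarith
  then show ?thesis
    using True by (simp add: pt_pd_def t_def)
next
  case False
  \<comment> \<open>In \<open>enat\<close>, 0 times \<infinity> is 0, so the product is infinite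
    only for a nonzero factor.\<close>
  have "card S \<noteq> 0"
    using assms by (metis card_0_eq finite_subset)
  then show ?thesis
    using False by (simp add: pt_pd_def imult_is_infinity enat_0_iff)
qed

theorem corollary2p6:
  fixes G :: "('a, 'b) pre_digraph"
  assumes "graph G" and "Digraph_Component.connected G"
  shows "enat (nat \<lceil>real (card (verts G)) / real (max_degree G + 1)\<rceil>) \<le> th_pd_times G"
proof -
  interpret graph G by fact
  have "verts G \<noteq> {}"
    using assms(2) by (auto simp: connected_def strongly_connected_def)
  \<comment> \<open>\<open>Min\<close> is characterised by its elements only on a nonempty finite
    set; the whole vertex set is one admissible \<open>S\<close>.\<close>
  then have "{S. S \<noteq> {} \<and> S \<subseteq> verts G} \<noteq> {}"
    by blast
  then show ?thesis
    unfolding th_pd_times_def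
    using ceiling_div_le_mult_pt_pd[of G] by (subst Min_ge_iff) (auto simp del: of_nat_add)
qed

end
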